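(* Let $\sigma$ be a finite nonempty signature of atoms. The class $\mathcal P^\sigma[\mathsf U]$ of peerless queries is polynomially characterisable within $\mathcal Q_p^\sigma[\mathsf U]$; that is, there is a polynomial $f$ such that every $q\in\mathcal P^\sigma[\mathsf U]$ is uniquely characterised within $\mathcal Q_p^\sigma[\mathsf U]$ by some example set $E$ with $|E|\le f(|q|)$.
   Context: A $\sigma$-data instance is a finite sequence $\mathcal D=(\delta_0,\dots,\delta_n)$ with $\delta_i\subseteq\sigma$, identified with its extensions by trailing $\emptyset$'s (so $\delta_\ell=\emptyset$ for $\ell>n$); $|\mathcal D|=\sum_i|\delta_i|$. Semantics at $\ell\in\mathbb N$: $\mathcal D,\ell\models A$ iff $A\in\delta_\ell$; $\mathcal D,\ell\models\top$; $\mathcal D,\ell\not\models\bot$; conjunction as usual; $\mathcal D,\ell\models q_1\mathbin{\mathsf U}q_2$ iff there is $m>\ell$ with $\mathcal D,m\models q_2$ and $\mathcal D,k\models q_1$ for all $k$ with $\ell<k<m$. Queries $q,q'$ are equivalent ($q\equiv q'$) if they are true at the same $(\mathcal D,\ell)$. $|q|$ is the number of symbols in $q$. $\mathcal Q_p^\sigma[\mathsf U]$ is the class of queries $$q=\rho_0\wedge(\lambda_1\mathbin{\mathsf U}(\rho_1\wedge(\lambda_2\mathbin{\mathsf U}(\dots(\lambda_n\mathbin{\mathsf U}\rho_n)\dots)))),\qquad n\ge0,$$ where each $\rho_i$ is a (possibly empty) conjunction of atoms from $\sigma$ and each $\lambda_i$ is either $\bot$ or a (possibly empty) conjunction of atoms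 from $\sigma$; conjunctions are identified with subsets of $\sigma$, the empty conjunction being $\top$. Such a query is peerless if for every $i\in\{1,\dots,n\}$ either $\lambda_i=\bot$ or the sets $\lambda_i$ and $\rho_i$ are incomparable with respect to $\subseteq$; $\mathcal P^\sigma[\mathsf U]$ is the class of peerless queries in $\mathcal Q_p^\sigma[\mathsf U]$. An example set is a pair $E=(E^+,E^-)$ of finite sets of $\sigma$-data instances, $|E|=\sum_{\mathcal D\in E^+\cup E^-}|\mathcal D|$. A query $q$ fits $E$ if $\mathcal D,0\models q$ for all $\mathcal D\in E^+$ and $\mathcal D,0\not\models q$ for all $\mathcal D\in E^-$. $E$ uniquely characterises $q$ within a class $\mathcal Q$ if $q$ fits $E$ and $q\equiv q'$ for all $q'\in\mathcal Q$ that fit $E$. *)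

theory Defs
  imports "HOL-Computational_Algebra.Polynomial"
begin

text \<open>
  A data instance is a finite sequence of sets of atoms, where sequences differing only by
  trailing empty sets are identified. Such a class of sequences is represented by the
  function of finite support obtained by padding with empty sets.
\<close>

type_synonym 'a data = "nat \<Rightarrow> 'a set"

definition data_instance :: "'a set \<Rightarrow> 'a data \<Rightarrow> bool" where
  "data_instance \<sigma> D \<longleftrightarrow> (\<forall>i. D i \<subseteq> \<sigma>) \<and> finite {i. D i \<noteq> {}}"

definition instance_size :: "'a data \<Rightarrow> nat" where
  "instance_size D = (\<Sum>i | D i \<noteq> {}. card (D i))"

datatype 'a query =
    Top
  | Bot
  | Atom 'a
  | And "'a query" "'a query"
  | Until "'a query" "'a query"

fun holds :: "'a data \<Rightarrow> nat \<Rightarrow> 'a query \<Rightarrow> bool" where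
  "holds D l Top \<longleftrightarrow> True"
| "holds D l Bot \<longleftrightarrow> False"
| "holds D l (Atom A) \<longleftrightarrow> A \<in> D l"
| "holds D l (And q1 q2) \<longleftrightarrow> holds D l q1 \<and> holds D l q2"
| "holds D l (Until q1 q2) \<longleftrightarrow>
     (\<exists>m>l. holds D m q2 \<and> (\<forall>k. l < k \<and> k < m \<longrightarrow> holds D k q1))"

text \<open>Number of symbols, parentheses not counted.\<close>

fun query_size :: "'a query \<Rightarrow> nat" where
  "query_size Top = 1"
| "query_size Bot = 1"
| "query_size (Atom A) = 1"
| "query_size (And q1 q2) = query_size q1 + 1 + query_size q2"
| "query_size (Until q1 q2) = query_size q1 + 1 + query_size q2"

definition equivalent :: "'a set \<Rightarrow> 'a query \<Rightarrow> 'a query \<Rightarrow> bool" where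
  "equivalent \<sigma> q q' \<longleftrightarrow>
     (\<forall>D l. data_instance \<sigma> D \<longrightarrow> (holds D l q \<longleftrightarrow> holds D l q'))"

text \<open>
  A conjunction of atoms is written down as a list of its conjuncts; the subset of the
  signature with which it is identified is the set of elements of that list.
\<close>

fun conjunction :: "'a list \<Rightarrow> 'a query" where
  "conjunction [] = Top"
| "conjunction [A] = Atom A"
| "conjunction (A # B # As) = And (Atom A) (conjunction (B # As))"

text \<open>
  In a pair \<open>(\<lambda>, \<rho>)\<close> the value \<open>None\<close> of \<open>\<lambda>\<close> stands for \<open>\<bottom>\<close>, as opposed to
  \<open>Some []\<close>, the empty conjunction \<open>\<top>\<close>.
\<close>

type_synonym 'a step = "'a list option \<times> 'a list"

fun guard :: "'a list option \<Rightarrow> 'a query" where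
  "guard None = Bot"
| "guard (Some As) = conjunction As"

fun path_query :: "'a list \<Rightarrow> 'a step list \<Rightarrow> 'a query" where
  "path_query r0 [] = conjunction r0"
| "path_query r0 ((l, r) # ps) = And (conjunction r0) (Until (guard l) (path_query r ps))"

fun step_over :: "'a set \<Rightarrow> 'a step \<Rightarrow> bool" where
  "step_over \<sigma> (None, r) \<longleftrightarrow> set r \<subseteq> \<sigma>"
| "step_over \<sigma> (Some l, r) \<longleftrightarrow> set l \<subseteq> \<sigma> \<and> set r \<subseteq> \<sigma>"

fun peerless_step :: "'a step \<Rightarrow> bool" where
  "peerless_step (None, r) \<longleftrightarrow> True"
| "peerless_step (Some l, r) \<longleftrightarrow> \<not> set l \<subseteq> set r \<and> \<not> set r \<subseteq> set l"

definition path_queries :: "'a set \<Rightarrow> 'a query set" where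
  "path_queries \<sigma> =
     {path_query r0 ps | r0 ps. set r0 \<subseteq> \<sigma> \<and> (\<forall>p \<in> set ps. step_over \<sigma> p)}"

definition peerless_queries :: "'a set \<Rightarrow> 'a query set" where
  "peerless_queries \<sigma> =
     {path_query r0 ps | r0 ps. set r0 \<subseteq> \<sigma> \<and> (\<forall>p \<in> set ps. step_over \<sigma> p \<and> peerless_step p)}"

text \<open>The components are the positive and the negative examples, in this order.\<close>

type_synonym 'a examples = "'a data set \<times> 'a data set"

definition example_set :: "'a set \<Rightarrow> 'a examples \<Rightarrow> bool" where
  "example_set \<sigma> E \<longleftrightarrow>
     finite (fst E) \<and> finite (snd E) \<and> (\<forall>D \<in> fst E \<union> snd E. data_instance \<sigma> D)"

definition examples_size :: "'a examples \<Rightarrow> nat" where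
  "examples_size E = (\<Sum>D \<in> fst E \<union> snd E. instance_size D)"

definition fits :: "'a query \<Rightarrow> 'a examples \<Rightarrow> bool" where
  "fits q E \<longleftrightarrow> (\<forall>D \<in> fst E. holds D 0 q) \<and> (\<forall>D \<in> snd E. \<not> holds D 0 q)"

definition uniquely_characterises ::
    "'a set \<Rightarrow> 'a examples \<Rightarrow> 'a query \<Rightarrow> 'a query set \<Rightarrow> bool" where
  "uniquely_characterises \<sigma> E q Q \<longleftrightarrow>
     fits q E \<and> (\<forall>q' \<in> Q. fits q' E \<longrightarrow> equivalent \<sigma> q q')"

end

theory Submission
  imports Defs
begin

text \<open>
  Write \<open>q\<close> with letters \<open>R 0, \<dots>, R n\<close> and guards \<open>L 0, \<dots>, L (n - 1)\<close>, \<open>L k\<close> guarding the gap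
  between letters \<open>k\<close> and \<open>k + 1\<close>, and with a nonempty last letter. As the size of the signature
  is a constant, one may afford a test instance for every gap \<open>i\<close> and every set \<open>X\<close> of atoms, and
  one may sort arbitrary test instances into positive and negative ones by evaluating \<open>q\<close> on them.
  The words \<open>R 0 \<dots> R n\<close>, \<open>\<sigma>\<dots>\<sigma>\<close> and \<open>\<sigma>\<dots>(\<sigma> - {A})\<dots>\<sigma>\<close> force a competitor to have the same letters.

  Among the competitors equivalent to the given one, choose guards \<open>L'\<close> that are absent as often and
  as early as possible. The words with one letter \<open>X\<close> inserted in gap \<open>i\<close> show that each \<open>L' i\<close>
  contains \<open>L i\<close> or \<open>R (i + 1)\<close>. In the word having one copy of every guard of \<open>q\<close>, letters of \<open>q'\<close>
  can only be matched late, and following the late matches from left to right shows that a guard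
  with \<open>L' i \<noteq> L i\<close> does not contain \<open>L i\<close>. For the last such \<open>i\<close> consider the words that have \<open>L' i\<close> in
  gap \<open>i\<close>, nothing in earlier gaps and arbitrarily many guards in later ones. If \<open>q\<close> fails in one of
  them, it fails in a short one by pumping, which is a test instance separating \<open>q\<close> from \<open>q'\<close>.
  If \<open>q\<close> holds in all of them, then \<open>L' i\<close> can be absorbed by the remaining part of the query and
  hence be replaced by \<open>\<bottom>\<close>, contradicting the choice of \<open>L'\<close>.
\<close>

section \<open>Embeddings of path queries\<close>

fun admits :: "'a set option \<Rightarrow> 'a set \<Rightarrow> bool" where
  "admits None X \<longleftrightarrow> False"
| "admits (Some s) X \<longleftrightarrow> s \<subseteq> X"

lemma admits_mono: "admits l X \<Longrightarrow> X \<subseteq> Y \<Longrightarrow> admits l Y"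
  by (cases l) auto

definition steps :: "nat \<Rightarrow> (nat \<Rightarrow> nat) \<Rightarrow> bool" where
  "steps n f \<longleftrightarrow> (\<forall>k<n. f k < f (Suc k))"

text \<open>Witness positions for the nested untils. \<open>f\<close>, \<open>L\<close> and
  \<open>R\<close> are total with an explicit length \<open>n\<close>, so that cutting off trailing
  letters only changes \<open>n\<close>.\<close>

definition emb :: "nat \<Rightarrow> (nat \<Rightarrow> 'a set option) \<Rightarrow> (nat \<Rightarrow> 'a set) \<Rightarrow> 'a data \<Rightarrow> (nat \<Rightarrow> nat) \<Rightarrow> bool" where
  "emb n L R D f \<longleftrightarrow> steps n f \<and> (\<forall>k\<le>n. R k \<subseteq> D (f k)) \<and>
     (\<forall>k<n. \<forall>y. f k < y \<and> y < f (Suc k) \<longrightarrow> admits (L k) (D y))"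

definition sat :: "nat \<Rightarrow> (nat \<Rightarrow> 'a set option) \<Rightarrow> (nat \<Rightarrow> 'a set) \<Rightarrow> 'a data \<Rightarrow> nat \<Rightarrow> bool" where
  "sat n L R D l \<longleftrightarrow> (\<exists>f. f 0 = l \<and> emb n L R D f)"

definition peerless :: "nat \<Rightarrow> (nat \<Rightarrow> 'a set option) \<Rightarrow> (nat \<Rightarrow> 'a set) \<Rightarrow> bool" where
  "peerless n L R \<longleftrightarrow>
     (\<forall>k<n. \<forall>s. L k = Some s \<longrightarrow> \<not> s \<subseteq> R (Suc k) \<and> \<not> R (Suc k) \<subseteq> s)"

lemma peerless_not_admits: "peerless n L R \<Longrightarrow> k < n \<Longrightarrow> \<not> admits (L k) (R (Suc k))"
  by (cases "L k") (auto simp: peerless_def)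

lemma steps_less_iff:
  assumes "steps n f" "j \<le> n" "k \<le> n"
  shows "f j < f k \<longleftrightarrow> j < k"
proof -
  have "f j < f k" if "j < k" "k \<le> n" for j k
    using that
  proof (induction k)
    case (Suc k)
    then have "f k < f (Suc k)" using assms(1) by (simp add: steps_def)
    with Suc show ?case by (cases "j = k") auto
  qed simp
  with assms(2,3) show ?thesis by (metis less_asym linorder_neqE_nat)
qed

lemma steps_eq_iff:
  assumes "steps n f" "j \<le> n" "k \<le> n"
  shows "f j = f k \<longleftrightarrow> j = k"
  using steps_less_iff[OF assms] steps_less_iff[OF assms(1,3,2)] by (metis less_irrefl linorder_neqE_nat)

lemma steps_diff: "steps n f \<Longrightarrow> j \<le> k \<Longrightarrow> k \<le> n \<Longrightarrow> f j + (k - j) \<le> f k"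
proof (induction k)
  case (Suc k)
  show ?case
  proof (cases "j = Suc k")
    case False
    with Suc have "f j + (k - j) \<le> f k" by simp
    moreover have "f k < f (Suc k)" using Suc by (simp add: steps_def)
    ultimately show ?thesis using Suc.prems False by simp
  qed simp
qed simp

text \<open>Squeezed from both sides: \<open>k \<le> f k\<close>, and
  \<open>f k + (n - k) \<le> f n \<le> n\<close>.\<close>

lemma steps_id:
  assumes "steps n f" "f n \<le> n" "k \<le> n"
  shows "f k = k"
  using steps_diff[OF assms(1), of 0 k] steps_diff[OF assms(1), of k n] assms by simp

lemma emb_steps: "emb n L R D f \<Longrightarrow> steps n f"
  by (simp add: emb_def)

lemma emb_point: "emb n L R D f \<Longrightarrow> k \<le> n \<Longrightarrow> R k \<subseteq> D (f k)"
  by (simp add: emb_def)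

lemma emb_gap: "emb n L R D f \<Longrightarrow> k < n \<Longrightarrow> f k < y \<Longrightarrow> y < f (Suc k) \<Longrightarrow> admits (L k) (D y)"
  by (simp add: emb_def)

lemma emb_less: "emb n L R D f \<Longrightarrow> k < n \<Longrightarrow> f k < f (Suc k)"
  by (simp add: emb_def steps_def)

lemma emb_cong:
  assumes "\<And>k. k < n \<Longrightarrow> L k = L' k" "\<And>k. k \<le> n \<Longrightarrow> R k = R' k"
  shows "emb n L R D f \<longleftrightarrow> emb n L' R' D f"
  using assms by (simp add: emb_def)

lemma sat_cong:
  assumes "\<And>k. k < n \<Longrightarrow> L k = L' k" "\<And>k. k \<le> n \<Longrightarrow> R k = R' k"
  shows "sat n L R D l \<longleftrightarrow> sat n L' R' D l"
  using emb_cong[OF assms] by (simp add: sat_def)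

text \<open>An empty last letter matches anywhere, so it can be put directly after its predecessor,
  leaving its guard an empty gap.\<close>

lemma sat_Suc_empty:
  assumes "R (Suc n) = {}"
  shows "sat (Suc n) L R D l \<longleftrightarrow> sat n L R D l"
proof
  assume "sat (Suc n) L R D l"
  then obtain f where "f 0 = l" "emb (Suc n) L R D f" by (auto simp: sat_def)
  then have "f 0 = l \<and> emb n L R D f" by (simp add: emb_def steps_def)
  then show "sat n L R D l" unfolding sat_def by (rule exI[of _ f])
next
  assume "sat n L R D l"
  then obtain f where f: "f 0 = l" "emb n L R D f" by (auto simp: sat_def)
  let ?f = "f(Suc n := Suc (f n))"
  have 1: "?f k < ?f (Suc k)" if "k < Suc n" for k
    using that emb_less[OF f(2), of k] by (cases "k = n") auto
  have 2: "R k \<subseteq> D (?f k)" if "k \<le> Suc n" for k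
    using that emb_point[OF f(2), of k] assms by (cases "k = Suc n") auto
  have 3: "admits (L k) (D y)" if "k < Suc n" "?f k < y" "y < ?f (Suc k)" for k y
    using that emb_gap[OF f(2), of k y] by (cases "k = n") auto
  have "emb (Suc n) L R D ?f"
    unfolding emb_def steps_def using 1 2 3 by blast
  then show "sat (Suc n) L R D l" unfolding sat_def using f(1) by (intro exI[of _ ?f]) simp
qed

lemma sat_trim:
  "\<exists>m\<le>n. (m = 0 \<or> R m \<noteq> {}) \<and> (\<forall>D l. sat n L R D l \<longleftrightarrow> sat m L R D l)"
proof (induction n)
  case (Suc n)
  show ?case
  proof (cases "R (Suc n) = {}")
    case True
    obtain m where m: "m \<le> n" "m = 0 \<or> R m \<noteq> {}" "\<forall>D l. sat n L R D l \<longleftrightarrow> sat m L R D l"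
      using Suc.IH by (elim exE conjE)
    have "\<forall>D l. sat (Suc n) L R D l \<longleftrightarrow> sat m L R D l"
      using sat_Suc_empty[where R = R and n = n, OF True] m(3) by simp
    with m show ?thesis by (intro exI[of _ m] conjI) simp_all
  next
    case False
    then show ?thesis by (intro exI[of _ "Suc n"] conjI) simp_all
  qed
qed simp

lemma last_bound:
  assumes "emb n L R D f" "n = 0 \<or> R n \<noteq> {}" "f 0 = 0" "\<And>y. N < y \<Longrightarrow> D y = {}"
  shows "f n \<le> N"
  using assms emb_point[OF assms(1), of n] by (metis bot_nat_0.extremum le_refl not_less subset_empty)

section \<open>Words\<close>

definition word :: "nat \<Rightarrow> (nat \<Rightarrow> nat) \<Rightarrow> (nat \<Rightarrow> 'a set) \<Rightarrow> (nat \<Rightarrow> 'a set) \<Rightarrow> 'a data" where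
  "word n g R S y = {a. (\<exists>j\<le>n. y = g j \<and> a \<in> R j) \<or> (\<exists>j<n. g j < y \<and> y < g (Suc j) \<and> a \<in> S j)}"

lemma word_cases:
  assumes "a \<in> word n g R S y"
  obtains k where "k \<le> n" "y = g k" "a \<in> R k"
    | k where "k < n" "g k < y" "y < g (Suc k)" "a \<in> S k"
  using assms unfolding word_def by blast

lemma word_point:
  assumes "steps n g" "j \<le> n"
  shows "word n g R S (g j) = R j"
proof -
  have "\<not> (g i < g j \<and> g j < g (Suc i))" if "i < n" for i
    using that steps_less_iff[OF assms(1)] assms(2) by simp
  then show ?thesis using steps_eq_iff[OF assms(1)] assms(2) by (auto simp: word_def)
qed

lemma word_gap:
  assumes "steps n g" "j < n" "g j < y" "y < g (Suc j)"
  shows "word n g R S y = S j"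
proof -
  have 1: "y \<noteq> g i" if "i \<le> n" for i
    using that assms steps_less_iff[OF assms(1), of j i] steps_less_iff[OF assms(1), of i "Suc j"] by auto
  have 2: "i = j" if "i < n" "g i < y" "y < g (Suc i)" for i
    using that assms steps_less_iff[OF assms(1), of j "Suc i"] steps_less_iff[OF assms(1), of i "Suc j"] by auto
  show ?thesis unfolding word_def using 1 2 assms(2-4) by blast
qed

lemma word_beyond:
  assumes "steps n g" "g n < y"
  shows "word n g R S y = {}"
proof -
  have "g i \<le> g n" if "i \<le> n" for i
    using steps_diff[OF assms(1) that] by simp
  then have "g i < y" if "i \<le> n" for i
    using that assms(2) by (metis le_less_trans)
  then have 1: "g i < y" if "i \<le> n" for i
    using that by blast
  have "y \<noteq> g i" if "i \<le> n" for i
    using 1[OF that] by simp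
  moreover have "\<not> y < g (Suc i)" if "i < n" for i
    using 1[of "Suc i"] that by simp
  ultimately show ?thesis by (auto simp: word_def)
qed

lemma word_over:
  assumes "\<And>j. j \<le> n \<Longrightarrow> R j \<subseteq> \<sigma>" "\<And>j. j < n \<Longrightarrow> S j \<subseteq> \<sigma>"
  shows "word n g R S y \<subseteq> \<sigma>"
  using assms by (auto simp: word_def)

lemma word_emb:
  assumes "steps n g" "\<And>j. j < n \<Longrightarrow> Suc (g j) < g (Suc j) \<Longrightarrow> admits (L j) (S j)"
  shows "emb n L R (word n g R S) g"
proof -
  have "admits (L j) (word n g R S y)" if "j < n" "g j < y" "y < g (Suc j)" for j y
    using assms(2)[OF that(1)] that(2,3) word_gap[OF assms(1) that, of R S] by simp
  then show ?thesis using assms(1) by (simp add: emb_def word_point)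
qed

lemma word_sat:
  assumes "steps n g" "g 0 = 0" "\<And>j. j < n \<Longrightarrow> Suc (g j) < g (Suc j) \<Longrightarrow> admits (L j) (S j)"
  shows "sat n L R (word n g R S) 0"
  using word_emb[OF assms(1,3)] assms(2) by (auto simp: sat_def)

text \<open>If letter \<open>Suc k\<close> were matched later than \<open>Suc k\<close>, that
  position, which carries \<open>R (Suc k)\<close>, would lie in gap \<open>k\<close>, whose guard
  does not admit it.\<close>

lemma peerless_prefix:
  assumes "peerless n L R" "emb n L R D f" "f 0 = 0" "i \<le> n" "\<And>k. k \<le> i \<Longrightarrow> D k = R k"
  shows "f i = i"
proof -
  have "f k = k" if "k \<le> i" for k
    using that
  proof (induction k)
    case 0
    then show ?case using assms by simp
  next
    case (Suc k)
    then have fk: "f k = k" and kn: "k < n" using assms(4) by auto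
    have "\<not> Suc k < f (Suc k)"
      using emb_gap[OF assms(2) kn, of "Suc k"] fk peerless_not_admits[OF assms(1) kn] assms(5)[OF Suc.prems]
      by auto
    then show ?case using emb_less[OF assms(2) kn] fk by simp
  qed
  then show ?thesis by simp
qed

text \<open>Inserting a copy of a letter that the embedding skips over.\<close>

lemma emb_pump:
  assumes "emb n L R D f" "\<And>k. k \<le> n \<Longrightarrow> f k \<noteq> p"
    and "\<And>y. y \<le> p \<Longrightarrow> D y \<subseteq> D' y" "\<And>y. p \<le> y \<Longrightarrow> D y \<subseteq> D' (Suc y)"
  shows "emb n L R D' (\<lambda>k. if f k \<le> p then f k else Suc (f k))"
proof -
  let ?h = "\<lambda>k. if f k \<le> p then f k else Suc (f k)"
  have "admits (L k) (D' y)" if k: "k < n" and y: "?h k < y" "y < ?h (Suc k)" for k y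
  proof (cases "y \<le> p")
    case True
    then have "admits (L k) (D y)" using y emb_gap[OF assms(1) k, of y] by (auto split: if_splits)
    then show ?thesis using admits_mono assms(3)[OF True] by blast
  next
    case False
    then obtain z where z: "y = Suc z" "p \<le> z" by (cases y) auto
    have "f k < z \<and> z < f (Suc k)"
      using y z assms(2)[of k] assms(2)[of "Suc k"] k by (auto split: if_splits)
    then have "admits (L k) (D z)" using emb_gap[OF assms(1) k] by blast
    then show ?thesis using admits_mono assms(4)[OF z(2)] z(1) by blast
  qed
  moreover have "R k \<subseteq> D' (?h k)" if "k \<le> n" for k
    using emb_point[OF assms(1) that] assms(3)[of "f k"] assms(4)[of "f k"] by (cases "f k \<le> p") auto
  moreover have "?h k < ?h (Suc k)" if "k < n" for k
    using emb_less[OF assms(1) that] by auto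
  ultimately show ?thesis by (simp add: emb_def steps_def)
qed

text \<open>Used in contrapositive form: failure in a word with a long gap persists when that gap is
  shortened by one position.\<close>

lemma word_pump:
  assumes "j < n" "steps n g" "g j + n + 4 < g (Suc j)" "g 0 = 0"
    and "sat n L R (word n (\<lambda>k. if k \<le> j then g k else g k - 1) R S) 0" (is "sat n L R ?W 0")
  shows "sat n L R (word n g R S) 0"
proof -
  let ?g = "\<lambda>k. if k \<le> j then g k else g k - 1"
  obtain f where f: "f 0 = 0" "emb n L R ?W f" using assms(5) by (auto simp: sat_def)
  \<comment> \<open>Pigeonhole: the shortened gap has more positions than the query has letters, so
    some \<open>p\<close> in it is skipped and can be duplicated.\<close>
  have "card (f ` {..n}) < card {g j<..<g (Suc j) - 1}"
    using card_image_le[of "{..n}" f] assms(3) by simp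
  then obtain p where p: "p \<in> {g j<..<g (Suc j) - 1}" "p \<notin> f ` {..n}"
    using card_mono[of "f ` {..n}" "{g j<..<g (Suc j) - 1}"] by fastforce
  have g: "g k \<le> g j" if "k \<le> j" for k
    using steps_diff[OF assms(2) that] assms(1) by simp
  have g': "g (Suc j) \<le> g k" if "j < k" "k \<le> n" for k
    using steps_diff[OF assms(2), of "Suc j" k] that by simp
  have 1: "?W y \<subseteq> word n g R S y" if "y \<le> p" for y
  proof
    fix a assume "a \<in> ?W y"
    then show "a \<in> word n g R S y"
    proof (cases rule: word_cases)
      case (1 k)
      then have "k \<le> j" using p(1) that g'[of k] by (auto split: if_splits)
      then show ?thesis using 1 by (auto simp: word_def)
    next
      case (2 k)
      then have "k \<le> j" using p(1) that g'[of k] by (auto split: if_splits)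
      then show ?thesis using 2 by (auto simp: word_def split: if_splits)
    qed
  qed
  have 2: "?W y \<subseteq> word n g R S (Suc y)" if "p \<le> y" for y
  proof
    fix a assume "a \<in> ?W y"
    then show "a \<in> word n g R S (Suc y)"
    proof (cases rule: word_cases)
      case (1 k)
      then have "j < k" using p(1) that g[of k] by (auto split: if_splits)
      then show ?thesis using 1 g'[of k] assms(3) by (auto simp: word_def)
    next
      case (2 k)
      then have "j \<le> k" using p(1) that g[of "Suc k"] by (auto split: if_splits)
      then show ?thesis using 2 g'[of k] assms(3) by (force simp: word_def split: if_splits)
    qed
  qed
  have "emb n L R (word n g R S) (\<lambda>k. if f k \<le> p then f k else Suc (f k))"
  proof (rule emb_pump[OF f(2)])
    show "f k \<noteq> p" if "k \<le> n" for k using p(2) that by auto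
  qed (fact 1 2)+
  then show ?thesis unfolding sat_def using f(1)
    by (intro exI[of _ "\<lambda>k. if f k \<le> p then f k else Suc (f k)"]) simp
qed

section \<open>Normal forms of guards\<close>

definition over :: "'a set \<Rightarrow> nat \<Rightarrow> (nat \<Rightarrow> 'a set option) \<Rightarrow> (nat \<Rightarrow> 'a set) \<Rightarrow> bool" where
  "over \<sigma> n L R \<longleftrightarrow> (\<forall>k\<le>n. R k \<subseteq> \<sigma>) \<and> (\<forall>k<n. \<forall>s. L k = Some s \<longrightarrow> s \<subseteq> \<sigma>)"

text \<open>Each present guard costs \<open>n - k > 0\<close>, so both dropping a guard and moving
  it one gap to the right lower the weight.\<close>

definition weight :: "nat \<Rightarrow> (nat \<Rightarrow> 'a set option) \<Rightarrow> nat" where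
  "weight n L = (\<Sum>k<n. if L k = None then 0 else n - k)"

definition normal :: "'a set \<Rightarrow> nat \<Rightarrow> (nat \<Rightarrow> 'a set option) \<Rightarrow> (nat \<Rightarrow> 'a set) \<Rightarrow> bool" where
  "normal \<sigma> n L R \<longleftrightarrow>
     (\<forall>L'. over \<sigma> n L' R \<longrightarrow> (\<forall>D l. sat n L' R D l \<longleftrightarrow> sat n L R D l) \<longrightarrow> weight n L \<le> weight n L')"

lemma ex_normal:
  assumes "over \<sigma> n L R"
  shows "\<exists>L'. over \<sigma> n L' R \<and> (\<forall>D l. sat n L' R D l \<longleftrightarrow> sat n L R D l) \<and> normal \<sigma> n L' R"
proof -
  let ?P = "\<lambda>L'. over \<sigma> n L' R \<and> (\<forall>D l. sat n L' R D l \<longleftrightarrow> sat n L R D l)"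
  have "?P L" using assms by simp
  from ex_has_least_nat[of ?P, OF this, of "weight n"]
  obtain L' where "?P L'" "\<And>L''. ?P L'' \<Longrightarrow> weight n L' \<le> weight n L''" by blast
  then show ?thesis unfolding normal_def by (intro exI[of _ L']) simp
qed

lemma weight_upd:
  assumes "k < n"
  shows "weight n (L(k := x)) + (if L k = None then 0 else n - k) = weight n L + (if x = None then 0 else n - k)"
proof -
  let ?w = "\<lambda>L j. if L j = None then 0 else n - j"
  have 1: "weight n M = ?w M k + (\<Sum>j\<in>{..<n} - {k}. ?w M j)" for M :: "nat \<Rightarrow> 'a set option"
    using assms by (simp add: weight_def sum.remove)
  have "(\<Sum>j\<in>{..<n} - {k}. ?w (L(k := x)) j) = (\<Sum>j\<in>{..<n} - {k}. ?w L j)"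
    by (rule sum.cong) auto
  then show ?thesis unfolding 1[of "L(k := x)"] 1[of L] by simp
qed

lemma sat_upd_None:
  assumes "sat n (L(k := None)) R D l"
  shows "sat n L R D l"
proof -
  obtain f where f: "f 0 = l" "emb n (L(k := None)) R D f" using assms by (auto simp: sat_def)
  have "admits (L j) (D y)" if "j < n" "f j < y" "y < f (Suc j)" for j y
    using emb_gap[OF f(2) that] by (cases "j = k") auto
  then have "emb n L R D f" using f(2) by (simp add: emb_def)
  then show ?thesis using f(1) by (auto simp: sat_def)
qed

lemma over_upd_None: "over \<sigma> n L R \<Longrightarrow> over \<sigma> n (L(k := None)) R"
  by (auto simp: over_def)

text \<open>Only one direction has to be checked, since replacing a guard by \<open>None\<close> can
  only strengthen a query.\<close>

lemma normal_upd_None: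
  assumes "normal \<sigma> n L R" "over \<sigma> n L R" "k < n" "L k \<noteq> None"
    and "\<And>D l. sat n L R D l \<Longrightarrow> sat n (L(k := None)) R D l"
  shows False
proof -
  have "weight n L \<le> weight n (L(k := None))"
    using assms(1) over_upd_None[OF assms(2)] assms(5) sat_upd_None unfolding normal_def by blast
  then show False using weight_upd[OF assms(3), of L None] assms(3,4) by simp
qed

text \<open>As guard \<open>k\<close> equals the letter it precedes, all of gap \<open>k\<close>
  carries this letter, which can therefore move to directly after \<open>f k\<close>. The vacated
  positions join gap \<open>Suc k\<close>, so the new guard \<open>t\<close> there must be contained
  in \<open>R (Suc k)\<close> and in whatever the old guard admits.\<close>

lemma emb_pull:
  assumes "emb n L R D f" "k < n" "L k = Some (R (Suc k))" "L' k = None"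
    and "\<And>j. j < n \<Longrightarrow> j \<noteq> k \<Longrightarrow> j \<noteq> Suc k \<Longrightarrow> L' j = L j"
    and "Suc k < n \<Longrightarrow> \<exists>t. L' (Suc k) = Some t \<and> t \<subseteq> R (Suc k) \<and> (\<forall>X. admits (L (Suc k)) X \<longrightarrow> t \<subseteq> X)"
  shows "emb n L' R D (f(Suc k := Suc (f k)))"
proof -
  let ?f = "f(Suc k := Suc (f k))"
  have R: "R (Suc k) \<subseteq> D y" if "f k < y" "y \<le> f (Suc k)" for y
    using that emb_gap[OF assms(1,2), of y] emb_point[OF assms(1), of "Suc k"] assms(2,3)
    by (cases "y = f (Suc k)") auto
  have fk: "f k < f (Suc k)" using emb_less[OF assms(1,2)] .
  have "?f j < ?f (Suc j)" if "j < n" for j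
    using emb_less[OF assms(1) that] fk by (cases "j = k"; cases "j = Suc k") auto
  moreover have "R j \<subseteq> D (?f j)" if "j \<le> n" for j
    using R[of "Suc (f k)"] fk emb_point[OF assms(1) that] by (cases "j = Suc k") auto
  moreover have "admits (L' j) (D y)" if j: "j < n" and y: "?f j < y" "y < ?f (Suc j)" for j y
  proof -
    consider "j = k" | "j = Suc k" | "j \<noteq> k" "j \<noteq> Suc k" by blast
    then show ?thesis
    proof cases
      case 1
      then show ?thesis using y by simp
    next
      case 2
      then obtain t where t: "L' j = Some t" "t \<subseteq> R j" "\<And>X. admits (L j) X \<Longrightarrow> t \<subseteq> X"
        using assms(6) j by blast
      have "t \<subseteq> D y"
      proof (cases "y \<le> f j")
        case True
        then show ?thesis using R[of y] t(2) y 2 by auto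
      next
        case False
        then show ?thesis using emb_gap[OF assms(1) j, of y] t(3) y 2 by simp
      qed
      then show ?thesis using t(1) by simp
    next
      case 3
      then show ?thesis using y emb_gap[OF assms(1) j, of y] assms(5)[OF j] by simp
    qed
  qed
  ultimately show ?thesis unfolding emb_def steps_def by blast
qed

text \<open>The reverse move: all positions of gap \<open>Suc k\<close> contain letter
  \<open>Suc k\<close>, so it can be matched immediately before the next letter, and the positions
  passed over join gap \<open>k\<close>.\<close>

lemma emb_push:
  assumes "emb n (L(k := None, Suc k := Some (R (Suc k)))) R D f" "Suc k < n" "L k = Some (R (Suc k))"
  shows "emb n L R D (f(Suc k := f (Suc (Suc k)) - 1))"
proof -
  let ?L = "L(k := None, Suc k := Some (R (Suc k)))"
  let ?f = "f(Suc k := f (Suc (Suc k)) - 1)"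
  have f1: "f (Suc k) = Suc (f k)"
    using emb_less[OF assms(1), of k] emb_gap[OF assms(1), of k "Suc (f k)"] assms(2) by fastforce
  have f2: "f (Suc k) < f (Suc (Suc k))" using emb_less[OF assms(1,2)] .
  have R: "R (Suc k) \<subseteq> D y" if "f (Suc k) \<le> y" "y < f (Suc (Suc k))" for y
    using that emb_gap[OF assms(1,2), of y] emb_point[OF assms(1), of "Suc k"] assms(2)
    by (cases "y = f (Suc k)") auto
  have "?f j < ?f (Suc j)" if "j < n" for j
    using emb_less[OF assms(1) that] f1 f2 by (cases "j = k"; cases "j = Suc k") auto
  moreover have "R j \<subseteq> D (?f j)" if "j \<le> n" for j
    using R[of "f (Suc (Suc k)) - 1"] f2 emb_point[OF assms(1) that] by (cases "j = Suc k") auto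
  moreover have "admits (L j) (D y)" if j: "j < n" and y: "?f j < y" "y < ?f (Suc j)" for j y
  proof -
    consider "j = k" | "j = Suc k" | "j \<noteq> k" "j \<noteq> Suc k" by blast
    then show ?thesis
    proof cases
      case 1
      then show ?thesis using y f1 R[of y] assms(3) by simp
    next
      case 2
      then show ?thesis using y by simp
    next
      case 3
      then show ?thesis using y emb_gap[OF assms(1) j, of y] by simp
    qed
  qed
  ultimately show ?thesis unfolding emb_def steps_def by blast
qed

text \<open>
  A guard equal to the letter it precedes is incomparable to the next guard: otherwise it is
  redundant, or it can be moved one gap to the right.
\<close>

lemma normal_guard:
  assumes "normal \<sigma> n L R" "over \<sigma> n L R" "k < n" "L k = Some (R (Suc k))"
  shows "Suc k < n \<and> (\<exists>Y. L (Suc k) = Some Y \<and> \<not> Y \<subseteq> R (Suc k) \<and> \<not> R (Suc k) \<subseteq> Y)"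
proof -
  \<comment> \<open>Otherwise pulling the letter to the left empties gap \<open>k\<close> while the
    next guard, if any, stays as it is, so guard \<open>k\<close> could be dropped.\<close>
  have 1: "\<not> (Suc k < n \<longrightarrow> (\<exists>t. L (Suc k) = Some t \<and> t \<subseteq> R (Suc k)))"
  proof
    assume a: "Suc k < n \<longrightarrow> (\<exists>t. L (Suc k) = Some t \<and> t \<subseteq> R (Suc k))"
    have "sat n (L(k := None)) R D l" if s: "sat n L R D l" for D l
    proof -
      obtain f where f: "f 0 = l" "emb n L R D f" using s by (auto simp: sat_def)
      have "emb n (L(k := None)) R D (f(Suc k := Suc (f k)))"
        by (rule emb_pull[OF f(2) assms(3,4)]) (use a in auto)
      then show ?thesis unfolding sat_def using f(1) by (intro exI[of _ "f(Suc k := Suc (f k))"]) simp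
    qed
    then show False using normal_upd_None[OF assms(1-3)] assms(4) by simp
  qed
  \<comment> \<open>Here the guard moves to gap \<open>Suc k\<close>, by \<open>emb_pull\<close> in
    one direction and \<open>emb_push\<close> in the other. The weight of the two gaps drops from at
    least \<open>n - k\<close> to \<open>n - Suc k\<close>.\<close>
  have "False" if a: "Suc k < n" "L (Suc k) = None \<or> (\<exists>Y. L (Suc k) = Some Y \<and> R (Suc k) \<subseteq> Y)"
  proof -
    let ?L = "L(k := None, Suc k := Some (R (Suc k)))"
    have "sat n ?L R D l" if s: "sat n L R D l" for D l
    proof -
      obtain f where f: "f 0 = l" "emb n L R D f" using s by (auto simp: sat_def)
      have "R (Suc k) \<subseteq> X" if "admits (L (Suc k)) X" for X
        using a(2) that by (elim disjE exE conjE) (simp, metis admits.simps(2) order_trans)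
      then have "emb n ?L R D (f(Suc k := Suc (f k)))"
        by (intro emb_pull[OF f(2) assms(3,4)]) auto
      then show ?thesis unfolding sat_def using f(1) by (intro exI[of _ "f(Suc k := Suc (f k))"]) simp
    qed
    moreover have "sat n L R D l" if s: "sat n ?L R D l" for D l
    proof -
      obtain f where f: "f 0 = l" "emb n ?L R D f" using s by (auto simp: sat_def)
      from emb_push[OF f(2) a(1) assms(4)] f(1) show ?thesis
        unfolding sat_def by (intro exI[of _ "f(Suc k := f (Suc (Suc k)) - 1)"]) simp
    qed
    moreover have "over \<sigma> n ?L R" using assms(2) a(1) by (auto simp: over_def)
    ultimately have "weight n L \<le> weight n ?L" using assms(1) unfolding normal_def by blast
    then show False
      using weight_upd[OF assms(3), of L None] weight_upd[OF a(1), of "L(k := None)" "Some (R (Suc k))"] a(1) assms(4)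
      by (simp split: if_splits)
  qed
  with 1 show ?thesis by (cases "L (Suc k)") auto
qed

section \<open>Agreement of the guards\<close>

text \<open>The value \<open>{}\<close> for an absent guard is harmless: in the words built from
  \<open>letters L\<close> below, its gap is empty or gets another letter.\<close>

definition letters :: "(nat \<Rightarrow> 'a set option) \<Rightarrow> nat \<Rightarrow> 'a set" where
  "letters L k = (case L k of None \<Rightarrow> {} | Some s \<Rightarrow> s)"

text \<open>Positions of the letters when every present guard fills its gap with exactly one copy
  and absent guards leave theirs empty.\<close>

fun full :: "(nat \<Rightarrow> 'a set option) \<Rightarrow> nat \<Rightarrow> nat" where
  "full L 0 = 0"
| "full L (Suc k) = full L k + (if L k = None then 1 else 2)"

definition bump :: "nat \<Rightarrow> nat \<Rightarrow> nat" where
  "bump i k = (if k \<le> i then k else Suc k)"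

text \<open>
  Positions of the letters in a word with a single letter in gap \<open>i\<close>, nothing in the
  earlier gaps, and an admissible number of guards in each later gap.
\<close>

definition shape :: "nat \<Rightarrow> (nat \<Rightarrow> 'a set option) \<Rightarrow> nat \<Rightarrow> (nat \<Rightarrow> nat) \<Rightarrow> bool" where
  "shape n L i g \<longleftrightarrow> steps n g \<and> (\<forall>k\<le>i. g k = k) \<and> g (Suc i) = i + 2 \<and>
     (\<forall>k<n. k \<noteq> i \<longrightarrow> L k = None \<longrightarrow> g (Suc k) = Suc (g k))"

lemma steps_full: "steps n (full L)"
  by (simp add: steps_def)

lemma shape_bump: "i < n \<Longrightarrow> shape n L i (bump i)"
  by (auto simp: shape_def bump_def steps_def)

lemma shape_before: "shape n L i g \<Longrightarrow> i < n \<Longrightarrow> k \<le> i \<Longrightarrow> word n g R S k = R k"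
  using word_point[of n g k R S] by (simp add: shape_def)

lemma shape_at: "shape n L i g \<Longrightarrow> i < n \<Longrightarrow> word n g R S (Suc i) = S i"
  using word_gap[of n g i "Suc i" R S] by (simp add: shape_def)

text \<open>With \<open>X\<close> inserted in gap \<open>i\<close> the query with guards
  \<open>L'\<close> holds, hence so does the one with \<open>L\<close>. By peerlessness its letters
  up to \<open>i\<close> sit at their own positions, so the inserted \<open>X\<close> is hit by
  letter \<open>Suc i\<close> or lies in gap \<open>i\<close>.\<close>

lemma guard_cases:
  assumes "peerless n L R" "i < n"
    and "sat n L' R (word n (bump i) R (\<lambda>_. X)) 0 \<longrightarrow> sat n L R (word n (bump i) R (\<lambda>_. X)) 0"
    and "L' i = Some X"
  shows "R (Suc i) \<subseteq> X \<or> admits (L i) X"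
proof -
  let ?W = "word n (bump i) R (\<lambda>_. X)"
  have "sat n L' R ?W 0"
  proof (rule word_sat)
    show "admits (L' j) X" if "Suc (bump i j) < bump i (Suc j)" for j
      using that assms(4) by (cases "j = i") (auto simp: bump_def split: if_splits)
  qed (simp_all add: bump_def steps_def)
  then obtain f where f: "f 0 = 0" "emb n L R ?W f" using assms(3) by (auto simp: sat_def)
  have sh: "shape n L i (bump i)" using shape_bump[OF assms(2)] .
  have fi: "f i = i"
    using assms(2) by (intro peerless_prefix[OF assms(1) f(2,1)] shape_before[OF sh]) simp_all
  have W: "?W (Suc i) = X" using shape_at[OF sh assms(2)] .
  show ?thesis
  proof (cases "f (Suc i) = Suc i")
    case True
    then show ?thesis using emb_point[OF f(2), of "Suc i"] W assms(2) by auto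
  next
    case False
    then have "Suc i < f (Suc i)" using emb_less[OF f(2) assms(2)] fi by simp
    then show ?thesis using emb_gap[OF f(2) assms(2), of "Suc i"] fi W by simp
  qed
qed

text \<open>
  The right-to-left argument: once all later guards agree, an offending guard can be absorbed,
  by re-embedding the remaining word starting from the last letter in its gap.
\<close>

lemma guard_absorbed:
  assumes "peerless n L R" "i < n" "L' i = Some Y" "\<not> admits (L i) Y"
    and "\<And>k. i < k \<Longrightarrow> k < n \<Longrightarrow> L' k = L k"
    and "\<And>g. shape n L i g \<Longrightarrow> sat n L R (word n g R ((letters L)(i := Y))) 0"
    and "sat n L' R D l"
  shows "sat n (L'(i := None)) R D l"
proof -
  \<comment> \<open>Induction on the number \<open>d\<close> of positions in gap \<open>i\<close>:
    as long as it is nonempty, letter \<open>Suc i\<close> can be moved one position to the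
    left.\<close>
  have "f 0 = l \<Longrightarrow> emb n L' R D f \<Longrightarrow> f (Suc i) - f i = Suc d \<Longrightarrow> ?thesis" for f d
  proof (induction d arbitrary: f)
    case 0
    have "admits ((L'(i := None)) k) (D y)" if "k < n" "f k < y" "y < f (Suc k)" for k y
      using that 0 emb_gap[OF 0(2), of k y] by (cases "k = i") auto
    then have "emb n (L'(i := None)) R D f" using 0(2) by (simp add: emb_def)
    then show ?case unfolding sat_def using 0(1) by blast
  next
    case (Suc d)
    have st: "steps n f" using emb_steps[OF Suc.prems(2)] .
    have le: "i \<le> f i" using steps_diff[OF st, of 0 i] assms(2) by simp
    \<comment> \<open>Position \<open>Suc i\<close> of the word built below corresponds to the last
      position of gap \<open>i\<close> in \<open>D\<close>, and \<open>c\<close> is the resulting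
      shift.\<close>
    define c where "c = f (Suc i) - (i + 2)"
    have c: "f (Suc i) = i + 2 + c" using Suc.prems(3) le by (simp add: c_def)
    have ci: "i + 2 + c \<le> f k" if "i < k" "k \<le> n" for k
      using steps_diff[OF st, of "Suc i" k] that c by simp
    define g where "g k = (if k \<le> i then k else f k - c)" for k
    have gc: "g k + c = f k" if "i < k" "k \<le> n" for k
      using that ci[OF that] by (simp add: g_def)
    have sg: "steps n g"
      unfolding steps_def
    proof (intro allI impI)
      fix k assume k: "k < n"
      consider "k < i" | "k = i" | "i < k" by linarith
      then show "g k < g (Suc k)"
      proof cases
        case 2
        then show ?thesis using c by (simp add: g_def)
      next
        case 3
        then show ?thesis using gc[of k] gc[of "Suc k"] k emb_less[OF Suc.prems(2) k] by simp
      qed (simp add: g_def)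
    qed
    have "g (Suc k) = Suc (g k)" if k: "k < n" "k \<noteq> i" "L k = None" for k
    proof (cases "k < i")
      case False
      then have "L' k = None" using assms(5)[of k] k by simp
      then have "f (Suc k) = Suc (f k)"
        using emb_less[OF Suc.prems(2) k(1)] emb_gap[OF Suc.prems(2) k(1), of "Suc (f k)"] by fastforce
      then show ?thesis using False k gc[of k] gc[of "Suc k"] by simp
    qed (simp add: g_def)
    then have sh: "shape n L i g" using sg c by (simp add: shape_def g_def)
    let ?W = "word n g R ((letters L)(i := Y))"
    obtain h where h: "h 0 = 0" "emb n L R ?W h"
      using assms(6)[OF sh] by (auto simp: sat_def)
    have hi: "h i = i"
      using assms(2) by (intro peerless_prefix[OF assms(1) h(2,1)] shape_before[OF sh]) simp_all
    have "?W (Suc i) = Y" using shape_at[OF sh assms(2), of R "(letters L)(i := Y)"] by simp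
    then have "\<not> Suc i < h (Suc i)"
      using emb_gap[OF h(2) assms(2), of "Suc i"] hi assms(4) by auto
    then have hsi: "h (Suc i) = Suc i"
      using emb_less[OF h(2) assms(2)] hi by simp
    have WD: "?W y \<subseteq> D (y + c)" if "i < y" for y
    proof
      fix a assume "a \<in> ?W y"
      then show "a \<in> D (y + c)"
      proof (cases rule: word_cases)
        case (1 k)
        then have "i < k" using that by (simp add: g_def split: if_splits)
        then show ?thesis using gc[of k] 1 emb_point[OF Suc.prems(2), of k] by auto
      next
        case (2 k)
        then have ik: "i \<le> k" using that by (simp add: g_def split: if_splits)
        have "f k < y + c"
        proof (cases "k = i")
          case True
          then show ?thesis using Suc.prems(3) c that by simp
        next
          case False
          then show ?thesis using gc[of k] 2 ik by simp
        qed
        moreover have "y + c < f (Suc k)" using gc[of "Suc k"] 2 ik by simp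
        ultimately have "admits (L' k) (D (y + c))" using emb_gap[OF Suc.prems(2) 2(1)] by simp
        moreover have "a \<in> s" if "L' k = Some s" for s
          using that 2 ik assms(3) assms(5)[of k] by (cases "k = i") (auto simp: letters_def)
        ultimately show ?thesis by (cases "L' k") auto
      qed
    qed
    \<comment> \<open>Old positions up to letter \<open>i\<close>, then the shifted embedding of the
      word; this takes letter \<open>Suc i\<close> to \<open>f (Suc i) - 1\<close>.\<close>
    define f' where "f' k = (if k \<le> i then f k else h k + c)" for k
    have hk: "i < h k" if "i < k" "k \<le> n" for k
      using steps_diff[OF emb_steps[OF h(2)], of "Suc i" k] hsi that by simp
    have f'si: "f' (Suc i) = f (Suc i) - 1" using hsi c by (simp add: f'_def)
    have "f' k < f' (Suc k)" if k: "k < n" for k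
    proof -
      consider "k < i" | "k = i" | "i < k" by linarith
      then show ?thesis
      proof cases
        case 1
        then show ?thesis using emb_less[OF Suc.prems(2) k] by (simp add: f'_def)
      next
        case 2
        then show ?thesis using f'si Suc.prems(3) by (simp add: f'_def)
      next
        case 3
        then show ?thesis using emb_less[OF h(2) k] by (simp add: f'_def)
      qed
    qed
    moreover have "R k \<subseteq> D (f' k)" if "k \<le> n" for k
    proof (cases "k \<le> i")
      case True
      then show ?thesis using emb_point[OF Suc.prems(2) that] by (simp add: f'_def)
    next
      case False
      then show ?thesis using emb_point[OF h(2) that] WD[OF hk[of k]] that by (auto simp: f'_def)
    qed
    moreover have "admits (L' k) (D y)" if k: "k < n" and y: "f' k < y" "y < f' (Suc k)" for k y
    proof -
      consider "k < i" | "k = i" | "i < k" by linarith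
      then show ?thesis
      proof cases
        case 1
        then show ?thesis using emb_gap[OF Suc.prems(2) k, of y] y by (simp add: f'_def)
      next
        case 2
        then have "f k < y" "y < f (Suc k)" using y f'si by (auto simp: f'_def)
        then show ?thesis using emb_gap[OF Suc.prems(2) k] by blast
      next
        case 3
        then obtain z where z: "y = z + c" "h k < z" "z < h (Suc k)"
          using y by (intro that[of "y - c"]) (auto simp: f'_def)
        have "admits (L k) (?W z)" using emb_gap[OF h(2) k z(2,3)] .
        moreover have "?W z \<subseteq> D y" using WD[of z] z hk[of k] 3 k by simp
        ultimately show ?thesis using admits_mono assms(5)[OF 3 k] by metis
      qed
    qed
    ultimately have "emb n L' R D f'" unfolding emb_def steps_def by blast
    moreover have "f' 0 = l" using Suc.prems(1) by (simp add: f'_def)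
    moreover have "f' (Suc i) - f' i = Suc d" using f'si Suc.prems(3) by (simp add: f'_def)
    ultimately show ?case using Suc.IH by blast
  qed
  moreover obtain f where f: "f 0 = l" "emb n L' R D f" using assms(7) by (auto simp: sat_def)
  moreover obtain d where "f (Suc i) - f i = Suc d"
    using emb_less[OF f(2) assms(2)] by (metis Suc_diff_Suc)
  ultimately show ?thesis by blast
qed

text \<open>\<open>single\<close>, \<open>full\<close> and \<open>shapes\<close> are what agreement
  on the test instances provides. \<open>shapes\<close> compares two universal statements because
  one test stands for all words of a shape: a failing one, if there is any.\<close>

lemma guards_eq:
  assumes pl: "peerless n L R" and tr: "n = 0 \<or> R n \<noteq> {}" and ov: "over \<sigma> n L' R"
    and nm: "normal \<sigma> n L' R"
    and single: "\<And>i X. i < n \<Longrightarrow> X \<subseteq> \<sigma> \<Longrightarrow>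
      sat n L' R (word n (bump i) R (\<lambda>_. X)) 0 \<longrightarrow> sat n L R (word n (bump i) R (\<lambda>_. X)) 0"
    and full: "sat n L' R (word n (full L) R (letters L)) 0"
    and shapes: "\<And>i X. i < n \<Longrightarrow> X \<subseteq> \<sigma> \<Longrightarrow>
      (\<And>g. shape n L i g \<Longrightarrow> sat n L' R (word n g R ((letters L)(i := X))) 0) \<Longrightarrow>
      (\<And>g. shape n L i g \<Longrightarrow> sat n L R (word n g R ((letters L)(i := X))) 0)"
    and k: "k < n"
  shows "L' k = L k"
proof -
  let ?g = "full L"
  let ?W = "word n ?g R (letters L)"
  have N1: "R (Suc i) \<subseteq> X \<or> (\<exists>s. L i = Some s \<and> s \<subseteq> X)" if i: "i < n" "L' i = Some X" for i X
  proof -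
    have "X \<subseteq> \<sigma>" using ov i by (simp add: over_def)
    then show ?thesis using guard_cases[OF pl i(1) single i(2)] i(1) by (cases "L i") auto
  qed
  have P: "\<not> s \<subseteq> R (Suc i)" "\<not> R (Suc i) \<subseteq> s" if "i < n" "L i = Some s" for i s
    using pl that by (auto simp: peerless_def)
  obtain f where f: "f 0 = 0" "emb n L' R ?W f" using full by (auto simp: sat_def)
  have sg: "steps n ?g" by (rule steps_full)
  have Wp: "?W (?g j) = R j" if "j \<le> n" for j using word_point[OF sg that] .
  have Wg: "?W (Suc (?g j)) = s" if "j < n" "L j = Some s" for j s
    using word_gap[OF sg that(1), of "Suc (?g j)" R "letters L"] that by (simp add: letters_def)
  \<comment> \<open>No letter is matched before its position in \<open>?W\<close>: the copy of guard
    \<open>j\<close> directly before letter \<open>Suc j\<close> does not contain that letter by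
    peerlessness.\<close>
  have fg: "?g j \<le> f j" if "j \<le> n" for j
    using that
  proof (induction j)
    case (Suc j)
    then have j: "j < n" and IH: "?g j \<le> f j" by auto
    have fj: "f j < f (Suc j)" using emb_less[OF f(2) j] .
    show ?case
    proof (cases "L j")
      case None
      then show ?thesis using IH fj by simp
    next
      case (Some s)
      have "f (Suc j) \<noteq> Suc (?g j)"
        using emb_point[OF f(2) Suc.prems] Wg[OF j Some] P[OF j Some] by metis
      then show ?thesis using IH fj Some by simp
    qed
  qed simp
  have fn: "f n \<le> ?g n"
    by (rule last_bound[OF f(2) tr f(1)]) (rule word_beyond[OF sg])
  \<comment> \<open>Left to right: lateness of letter \<open>Suc j\<close> forces
    \<open>L' j = Some (R (Suc j))\<close>, and \<open>normal_guard\<close> then makes the next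
    guard incomparable to that letter.\<close>
  have late: "j < n \<and> f j < ?g (Suc j) \<and> (\<exists>Y s. L' j = Some Y \<and> L j = Some s \<and> \<not> s \<subseteq> Y)"
    if "j \<le> n" "?g j < f j" for j
    using that
  proof (induction j)
    case 0
    then show ?case using f(1) by simp
  next
    case (Suc j)
    then have j: "j < n" by simp
    have "f j < ?g (Suc j)"
    proof (cases "?g j < f j")
      case True
      then show ?thesis using Suc.IH j by simp
    next
      case False
      then show ?thesis using fg[of j] j by simp
    qed
    then have gap: "admits (L' j) (?W y)" if "?g (Suc j) \<le> y" "y < f (Suc j)" for y
      using that emb_gap[OF f(2) j, of y] by simp
    have "admits (L' j) (R (Suc j))" using gap[of "?g (Suc j)"] Suc.prems Wp[of "Suc j"] by simp
    then obtain Z where Z: "L' j = Some Z" "Z \<subseteq> R (Suc j)" by (cases "L' j") auto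
    with N1[OF j Z(1)] P[OF j] have eq: "L' j = Some (R (Suc j))" by fastforce
    then obtain Y where j': "Suc j < n" and Y: "L' (Suc j) = Some Y" "\<not> Y \<subseteq> R (Suc j)" "\<not> R (Suc j) \<subseteq> Y"
      using normal_guard[OF nm ov j] by blast
    \<comment> \<open>Gap \<open>j\<close> extends over the positions passed by the late letter, so
      each of them contains \<open>R (Suc j)\<close>. This limits how far \<open>f (Suc j)\<close>
      can go.\<close>
    have sub: "R (Suc j) \<subseteq> ?W y" if "?g (Suc j) < y" "y \<le> f (Suc j)" for y
      using that gap[of y] eq emb_point[OF f(2) Suc.prems(1)] by (cases "y = f (Suc j)") auto
    have nsub: "\<not> R (Suc j) \<subseteq> R (Suc (Suc j))" if "R (Suc (Suc j)) \<subseteq> Y"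
      using that Y(3) by blast
    show ?case
    proof (cases "L (Suc j)")
      case None
      \<comment> \<open>Without a guard, a late letter reaches at least the position of the next
        one, and \<open>R (Suc j)\<close> would be contained in \<open>Y\<close>.\<close>
      then have "R (Suc j) \<subseteq> R (Suc (Suc j))"
        using sub[of "?g (Suc (Suc j))"] Wp[of "Suc (Suc j)"] Suc.prems j' by simp
      moreover have "R (Suc (Suc j)) \<subseteq> Y" using N1[OF j' Y(1)] None by simp
      ultimately show ?thesis using nsub by blast
    next
      case (Some s)
      have "R (Suc j) \<subseteq> s"
        using sub[of "Suc (?g (Suc j))"] Wg[OF j' Some] Suc.prems by simp
      then have s: "\<not> s \<subseteq> Y" using Y(3) by blast
      then have "R (Suc (Suc j)) \<subseteq> Y" using N1[OF j' Y(1)] Some by auto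
      then have "\<not> R (Suc j) \<subseteq> ?W (?g (Suc (Suc j)))"
        using nsub Wp[of "Suc (Suc j)"] j' by simp
      moreover have "?g (Suc j) < ?g (Suc (Suc j))" by simp
      ultimately have "f (Suc j) < ?g (Suc (Suc j))"
        using sub not_less by blast
      then show ?thesis using j' Y(1) Some s by blast
    qed
  qed
  \<comment> \<open>If letter \<open>i\<close> is not late, the copy of \<open>L i\<close> lies in
    gap \<open>i\<close>, so \<open>L' i\<close> is contained in \<open>L i\<close>; being
    different, it cannot contain it.\<close>
  have bad: "\<exists>Y. L' i = Some Y \<and> \<not> admits (L i) Y" if i: "i < n" and ne: "L' i \<noteq> L i" for i
  proof (cases "L i")
    case None
    then show ?thesis using ne by (cases "L' i") auto
  next
    case (Some s)
    show ?thesis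
    proof (cases "?g i < f i")
      case True
      then show ?thesis using late[of i] i Some by auto
    next
      case False
      then have "f i < Suc (?g i)" by simp
      moreover have "Suc (?g i) < f (Suc i)" using fg[of "Suc i"] i Some by simp
      ultimately have "admits (L' i) s" using emb_gap[OF f(2) i] Wg[OF i Some] by metis
      then obtain Y where Y: "L' i = Some Y" "Y \<subseteq> s" by (cases "L' i") auto
      with ne Some have "\<not> s \<subseteq> Y" by auto
      with Y Some show ?thesis by simp
    qed
  qed
  show ?thesis
  proof (rule ccontr)
    assume ne: "L' k \<noteq> L k"
    let ?B = "{i. i < n \<and> L' i \<noteq> L i}"
    \<comment> \<open>The last disagreement is taken, so that all later guards agree, as
      \<open>guard_absorbed\<close> requires.\<close>
    define i where "i = Max ?B"
    have fin: "finite ?B" by simp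
    have "i \<in> ?B" unfolding i_def using ne k by (intro Max_in[OF fin]) blast
    then have i: "i < n" "L' i \<noteq> L i" by auto
    have later: "L' j = L j" if "i < j" "j < n" for j
      using that Max_ge[OF fin, of j] by (fastforce simp: i_def)
    obtain Y where Y: "L' i = Some Y" "\<not> admits (L i) Y" using bad[OF i] by blast
    have Yo: "Y \<subseteq> \<sigma>" using ov i Y by (simp add: over_def)
    have "sat n L' R (word n g R ((letters L)(i := Y))) 0" if g: "shape n L i g" for g
    proof (rule word_sat)
      show "steps n g" "g 0 = 0" using g by (auto simp: shape_def)
      fix j assume j: "j < n" "Suc (g j) < g (Suc j)"
      consider "j < i" | "j = i" | "i < j" by linarith
      then show "admits (L' j) (((letters L)(i := Y)) j)"
      proof cases
        case 1
        then show ?thesis using j g by (simp add: shape_def)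
      next
        case 2
        then show ?thesis using Y by simp
      next
        case 3
        then have "L j \<noteq> None" using j g by (auto simp: shape_def)
        then show ?thesis using 3 later[OF 3 j(1)] by (auto simp: letters_def)
      qed
    qed
    then have sh: "sat n L R (word n g R ((letters L)(i := Y))) 0" if "shape n L i g" for g
      using shapes[OF i(1) Yo] that by blast
    have "sat n (L'(i := None)) R D l" if "sat n L' R D l" for D l
      using guard_absorbed[OF pl i(1) Y later sh that] .
    then show False using normal_upd_None[OF nm ov i(1)] Y(1) by simp
  qed
qed

section \<open>The test instances\<close>

text \<open>Take a failing word with least \<open>g n\<close>. If consecutive letters were more than
  \<open>n + 4\<close> apart, \<open>word_pump\<close> would give a shorter failing word.\<close>

lemma ex_short_shape:
  assumes "i < n" "shape n L i g0" "\<not> sat n L R (word n g0 R S) 0"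
  shows "\<exists>g. shape n L i g \<and> \<not> sat n L R (word n g R S) 0 \<and> g n < (n + 4)\<^sup>2"
proof -
  let ?P = "\<lambda>g. shape n L i g \<and> \<not> sat n L R (word n g R S) 0"
  have "?P g0" using assms by simp
  from ex_has_least_nat[of ?P, OF this, of "\<lambda>g. g n"]
  obtain g where sh: "shape n L i g" and ns: "\<not> sat n L R (word n g R S) 0"
    and least: "\<And>g'. ?P g' \<Longrightarrow> g n \<le> g' n" by blast
  have st: "steps n g" and g0: "g 0 = 0" using sh by (auto simp: shape_def)
  have gap: "g (Suc j) \<le> g j + (n + 4)" if j: "j < n" for j
  proof (rule ccontr)
    assume "\<not> ?thesis"
    then have big: "g j + n + 4 < g (Suc j)" by simp
    \<comment> \<open>Gaps up to \<open>i\<close> have at most one position, so the long gap comes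
      later and shortening it keeps the shape.\<close>
    have ij: "i < j"
    proof (rule ccontr)
      assume "\<not> i < j"
      then have "g (Suc j) \<le> g j + 2" using sh by (cases "j = i") (auto simp: shape_def)
      with big show False by simp
    qed
    let ?g = "\<lambda>k. if k \<le> j then g k else g k - 1"
    have up: "g (Suc j) \<le> g k" if "j < k" "k \<le> n" for k
      using steps_diff[OF st, of "Suc j" k] that by simp
    have "?g k < ?g (Suc k)" if k: "k < n" for k
    proof -
      have "g k < g (Suc k)" using st k by (simp add: steps_def)
      then show ?thesis using big up[of k] k by (cases "k = j") auto
    qed
    moreover have "?g (Suc k) = Suc (?g k)" if k: "k < n" "k \<noteq> i" "L k = None" for k
    proof -
      have "g (Suc k) = Suc (g k)" using sh k by (simp add: shape_def)
      then show ?thesis using big up[of k] k by (cases "k = j") auto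
    qed
    ultimately have "shape n L i ?g"
      using sh ij unfolding shape_def steps_def by auto
    moreover have "\<not> g n \<le> ?g n" using j up[of n] big by simp
    ultimately have "sat n L R (word n ?g R S) 0" using least[of ?g] by blast
    then show False using word_pump[OF j st big g0] ns by blast
  qed
  have "g k \<le> k * (n + 4)" if "k \<le> n" for k
    using that
  proof (induction k)
    case (Suc k)
    then show ?case using gap[of k] by simp
  qed (simp add: g0)
  then have "g n \<le> n * (n + 4)" by simp
  also have "\<dots> < (n + 4)\<^sup>2" by (simp add: power2_eq_square)
  finally show ?thesis using sh ns by blast
qed

lemma id_sat: "(\<And>k. k \<le> n \<Longrightarrow> R k \<subseteq> D k) \<Longrightarrow> sat n L R D 0"
  unfolding sat_def by (intro exI[of _ "\<lambda>k. k"]) (auto simp: emb_def steps_def)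

text \<open>Too short by one for a query with \<open>n + 1\<close> letters whose last one is
  nonempty, but satisfying every query over \<open>\<sigma>\<close> with fewer letters.\<close>

definition truncated :: "'a set \<Rightarrow> nat \<Rightarrow> 'a data" where
  "truncated \<sigma> n y = (if y < n then \<sigma> else {})"

definition punctured :: "'a set \<Rightarrow> nat \<Rightarrow> nat \<Rightarrow> 'a \<Rightarrow> 'a data" where
  "punctured \<sigma> n i A y = (if y \<le> n then if y = i then \<sigma> - {A} else \<sigma> else {})"

text \<open>The word without gaps gives \<open>m \<le> n\<close> and, once \<open>m = n\<close>,
  \<open>R' k \<subseteq> R k\<close>. The truncated instance excludes \<open>m < n\<close>, and the
  punctured ones detect an atom of \<open>R k\<close> missing in \<open>R' k\<close>.\<close>

lemma same_letters:
  assumes ov: "over \<sigma> n L R" "over \<sigma> m L' R'" and tr: "n = 0 \<or> R n \<noteq> {}" "m = 0 \<or> R' m \<noteq> {}"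
    and a1: "sat m L' R' (word n (\<lambda>k. k) R (\<lambda>_. {})) 0"
    and a2: "sat m L' R' (truncated \<sigma> n) 0 \<Longrightarrow> sat n L R (truncated \<sigma> n) 0"
    and a3: "\<And>i A. i \<le> n \<Longrightarrow> A \<in> \<sigma> \<Longrightarrow>
      sat m L' R' (punctured \<sigma> n i A) 0 \<Longrightarrow> sat n L R (punctured \<sigma> n i A) 0"
  shows "m = n \<and> (\<forall>k\<le>n. R' k = R k)"
proof -
  let ?W = "word n (\<lambda>k. k) R (\<lambda>_. {})"
  have sid: "steps n (\<lambda>k. k)" by (simp add: steps_def)
  obtain f where f: "f 0 = 0" "emb m L' R' ?W f" using a1 by (auto simp: sat_def)
  have fm: "f m \<le> n"
    by (rule last_bound[OF f(2) tr(2) f(1)]) (rule word_beyond[OF sid])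
  have "m \<le> f m" using steps_diff[OF emb_steps[OF f(2)], of 0 m] by simp
  with fm have "m \<le> n" by simp
  moreover have "\<not> m < n"
  proof
    assume mn: "m < n"
    have "sat m L' R' (truncated \<sigma> n) 0"
      using ov(2) mn by (intro id_sat) (auto simp: over_def truncated_def)
    then obtain h where h: "h 0 = 0" "emb n L R (truncated \<sigma> n) h" using a2 by (auto simp: sat_def)
    have "h n \<le> n - 1"
      by (rule last_bound[OF h(2) tr(1) h(1)]) (use mn in \<open>auto simp: truncated_def\<close>)
    moreover have "n \<le> h n" using steps_diff[OF emb_steps[OF h(2)], of 0 n] by simp
    ultimately show False using mn by simp
  qed
  ultimately have mn: "m = n" by simp
  have "R' k \<subseteq> R k" if k: "k \<le> n" for k
  proof -
    have "f k = k" using steps_id[OF emb_steps[OF f(2)], of k] fm k mn by simp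
    then show ?thesis using emb_point[OF f(2), of k] word_point[OF sid k, of R "\<lambda>_. {}"] k mn by simp
  qed
  moreover have "R k \<subseteq> R' k" if k: "k \<le> n" for k
  proof
    fix A assume A: "A \<in> R k"
    show "A \<in> R' k"
    proof (rule ccontr)
      assume nA: "A \<notin> R' k"
      have "sat m L' R' (punctured \<sigma> n k A) 0"
        using ov(2) mn nA by (intro id_sat) (auto simp: over_def punctured_def)
      moreover have "A \<in> \<sigma>" using ov(1) A k by (auto simp: over_def)
      ultimately obtain h where h: "h 0 = 0" "emb n L R (punctured \<sigma> n k A) h"
        using a3[OF k] by (auto simp: sat_def)
      have "h n \<le> n"
        by (rule last_bound[OF h(2) tr(1) h(1)]) (simp add: punctured_def)
      then have "h k = k" using steps_id[OF emb_steps[OF h(2)] _ k] by simp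
      then show False using emb_point[OF h(2) k] A k by (auto simp: punctured_def)
    qed
  qed
  ultimately show ?thesis using mn by blast
qed

lemma full_le: "full L k \<le> 2 * k"
  by (induction k) auto

lemma over_mono: "over \<sigma> n L R \<Longrightarrow> m \<le> n \<Longrightarrow> over \<sigma> m L R"
  unfolding over_def by (meson le_trans less_le_trans)

lemma over_cong:
  assumes "\<And>k. k \<le> n \<Longrightarrow> R k = R' k"
  shows "over \<sigma> n L R \<longleftrightarrow> over \<sigma> n L R'"
  using assms by (simp add: over_def)

definition bounded_data :: "'a set \<Rightarrow> nat \<Rightarrow> 'a data set" where
  "bounded_data \<sigma> N = {D. (\<forall>y. D y \<subseteq> \<sigma>) \<and> (\<forall>y\<ge>N. D y = {})}"

lemma word_bounded:
  assumes "over \<sigma> n L R" "steps n g" "g n < N" "\<And>k. k < n \<Longrightarrow> S k \<subseteq> \<sigma>"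
  shows "word n g R S \<in> bounded_data \<sigma> N"
proof -
  have "word n g R S y \<subseteq> \<sigma>" for y
    using assms(1,4) by (intro word_over) (auto simp: over_def)
  moreover have "word n g R S y = {}" if "N \<le> y" for y
    using assms(3) that by (intro word_beyond[OF assms(2)]) simp
  ultimately show ?thesis by (simp add: bounded_data_def)
qed

text \<open>In the first alternative \<open>W\<close> is a dummy, so that one instance can be chosen
  uniformly for all \<open>i\<close> and \<open>X\<close>.\<close>

lemma ex_test_word:
  assumes "over \<sigma> n L R" "i < n" "X \<subseteq> \<sigma>"
  defines "S \<equiv> (letters L)(i := X)"
  shows "\<exists>W \<in> bounded_data \<sigma> ((n + 4)\<^sup>2).
    (\<forall>g. shape n L i g \<longrightarrow> sat n L R (word n g R S) 0) \<or>
    (\<exists>g. shape n L i g \<and> W = word n g R S \<and> \<not> sat n L R (word n g R S) 0)"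
proof (cases "\<forall>g. shape n L i g \<longrightarrow> sat n L R (word n g R S) 0")
  case True
  then show ?thesis by (intro bexI[of _ "\<lambda>_. {}"] disjI1) (auto simp: bounded_data_def)
next
  case False
  then obtain g where g: "shape n L i g" "\<not> sat n L R (word n g R S) 0" "g n < (n + 4)\<^sup>2"
    using ex_short_shape[OF assms(2)] by blast
  have "S k \<subseteq> \<sigma>" if "k < n" for k
    using assms(1,3) that by (auto simp: S_def letters_def over_def split: option.split)
  then have "word n g R S \<in> bounded_data \<sigma> ((n + 4)\<^sup>2)"
    using g by (intro word_bounded[OF assms(1)]) (auto simp: shape_def)
  then show ?thesis using g by blast
qed

text \<open>Three single instances, one punctured instance per letter and atom, and two instances
  per gap and subset of \<open>\<sigma>\<close> give the bound on \<open>card C\<close>.\<close>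

lemma ex_test_set:
  assumes fin: "finite \<sigma>" and ov: "over \<sigma> n L R" and pl: "peerless n L R" and tr: "n = 0 \<or> R n \<noteq> {}"
  shows "\<exists>C \<subseteq> bounded_data \<sigma> ((n + 4)\<^sup>2). finite C \<and> card C \<le> (3 + card \<sigma> + 2 * 2 ^ card \<sigma>) * (n + 1) \<and>
    (\<forall>m L' R'. over \<sigma> m L' R' \<longrightarrow> (\<forall>D\<in>C. sat m L' R' D 0 \<longleftrightarrow> sat n L R D 0) \<longrightarrow>
      (\<forall>D l. sat m L' R' D l \<longleftrightarrow> sat n L R D l))"
proof -
  let ?N = "(n + 4)\<^sup>2"
  have N: "2 * n + 2 < ?N" by (simp add: power2_eq_square algebra_simps)
  let ?P = "\<lambda>i X W. W \<in> bounded_data \<sigma> ?N \<and>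
    ((\<forall>g. shape n L i g \<longrightarrow> sat n L R (word n g R ((letters L)(i := X))) 0) \<or>
     (\<exists>g. shape n L i g \<and> W = word n g R ((letters L)(i := X)) \<and> \<not> sat n L R W 0))"
  define V where "V i X = (SOME W. ?P i X W)" for i X
  have V: "?P i X (V i X)" if "i < n" "X \<subseteq> \<sigma>" for i X
  proof -
    have "\<exists>W. ?P i X W" using ex_test_word[OF ov that] by blast
    then show ?thesis unfolding V_def by (rule someI_ex)
  qed
  let ?W1 = "word n (\<lambda>k. k) R (\<lambda>_. {})"
  let ?W2 = "word n (full L) R (letters L)"
  let ?F3 = "(\<lambda>(i, A). punctured \<sigma> n i A) ` ({..n} \<times> \<sigma>)"
  let ?F4 = "(\<lambda>(i, X). word n (bump i) R (\<lambda>_. X)) ` ({..<n} \<times> Pow \<sigma>)"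
  let ?F5 = "(\<lambda>(i, X). V i X) ` ({..<n} \<times> Pow \<sigma>)"
  define C where "C = {?W1, ?W2, truncated \<sigma> n} \<union> ?F3 \<union> ?F4 \<union> ?F5"
  have "?W1 \<in> bounded_data \<sigma> ?N"
    using N by (intro word_bounded[OF ov]) (auto simp: steps_def)
  moreover have "?W2 \<in> bounded_data \<sigma> ?N"
  proof (rule word_bounded[OF ov steps_full])
    show "full L n < ?N" using full_le[of L n] N by simp
    show "letters L k \<subseteq> \<sigma>" if "k < n" for k
      using ov that by (auto simp: letters_def over_def split: option.split)
  qed
  moreover have "truncated \<sigma> n \<in> bounded_data \<sigma> ?N" "?F3 \<subseteq> bounded_data \<sigma> ?N"
    using N by (auto simp: bounded_data_def truncated_def punctured_def split: if_splits)
  moreover have "?F4 \<subseteq> bounded_data \<sigma> ?N"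
  proof -
    have "word n (bump i) R (\<lambda>_. X) \<in> bounded_data \<sigma> ?N" if "i < n" "X \<subseteq> \<sigma>" for i X
      using N that by (intro word_bounded[OF ov]) (simp_all add: bump_def steps_def)
    then show ?thesis by auto
  qed
  moreover have "?F5 \<subseteq> bounded_data \<sigma> ?N" using V by auto
  ultimately have C: "C \<subseteq> bounded_data \<sigma> ?N" unfolding C_def by simp
  have finC: "finite C" unfolding C_def using fin by simp
  have "card C \<le> card {?W1, ?W2, truncated \<sigma> n} + card ?F3 + card ?F4 + card ?F5"
    unfolding C_def by (meson card_Un_le add_le_mono le_refl le_trans)
  also have "\<dots> \<le> 3 + (n + 1) * card \<sigma> + n * 2 ^ card \<sigma> + n * 2 ^ card \<sigma>"
  proof (intro add_mono)
    show "card {?W1, ?W2, truncated \<sigma> n} \<le> 3" by (simp add: card_insert_if)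
    show "card ?F3 \<le> (n + 1) * card \<sigma>"
      using card_image_le[of "{..n} \<times> \<sigma>"] fin by (simp add: card_cartesian_product)
    show "card ?F4 \<le> n * 2 ^ card \<sigma>" "card ?F5 \<le> n * 2 ^ card \<sigma>"
      using card_image_le[of "{..<n} \<times> Pow \<sigma>"] fin by (simp_all add: card_cartesian_product card_Pow)
  qed
  also have "\<dots> \<le> (3 + card \<sigma> + 2 * 2 ^ card \<sigma>) * (n + 1)" by (simp add: algebra_simps)
  finally have cardC: "card C \<le> (3 + card \<sigma> + 2 * 2 ^ card \<sigma>) * (n + 1)" .
  have "sat m0 L0 R0 D l \<longleftrightarrow> sat n L R D l"
    if ov0: "over \<sigma> m0 L0 R0" and agree0: "\<And>D. D \<in> C \<Longrightarrow> sat m0 L0 R0 D 0 \<longleftrightarrow> sat n L R D 0"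
    for m0 L0 R0 D l
  proof -
    \<comment> \<open>Trailing empty letters of the competitor are cut off, so that
      \<open>same_letters\<close> applies.\<close>
    obtain m where m: "m \<le> m0" "m = 0 \<or> R0 m \<noteq> {}" "\<And>D l. sat m0 L0 R0 D l \<longleftrightarrow> sat m L0 R0 D l"
      using sat_trim[where n = m0 and R = R0 and L = L0] by (elim exE conjE) simp
    have ovm: "over \<sigma> m L0 R0" using over_mono[OF ov0 m(1)] .
    have agreem: "sat m L0 R0 D 0 \<longleftrightarrow> sat n L R D 0" if "D \<in> C" for D
      using agree0[OF that] m(3) by simp
    have W1: "sat n L R ?W1 0" by (rule word_sat) (simp_all add: steps_def)
    have W2: "sat n L R ?W2 0"
      by (rule word_sat[OF steps_full]) (auto simp: letters_def split: if_splits)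
    have mem: "?W1 \<in> C" "?W2 \<in> C" "truncated \<sigma> n \<in> C"
      "\<And>i A. i \<le> n \<Longrightarrow> A \<in> \<sigma> \<Longrightarrow> punctured \<sigma> n i A \<in> C"
      "\<And>i X. i < n \<Longrightarrow> X \<subseteq> \<sigma> \<Longrightarrow> word n (bump i) R (\<lambda>_. X) \<in> C"
      "\<And>i X. i < n \<Longrightarrow> X \<subseteq> \<sigma> \<Longrightarrow> V i X \<in> C"
      unfolding C_def by auto
    have "m = n \<and> (\<forall>k\<le>n. R0 k = R k)"
      by (rule same_letters[OF ov ovm tr m(2)]) (use agreem mem W1 in blast)+
    then have mn: "m = n" and R0: "\<And>k. k \<le> n \<Longrightarrow> R0 k = R k" by auto
    have eq0: "sat m L0 R0 D l \<longleftrightarrow> sat n L0 R D l" for D l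
      unfolding mn using R0 by (intro sat_cong) auto
    have ovn: "over \<sigma> n L0 R" using ovm over_cong[OF R0] mn by simp
    obtain L' where ov': "over \<sigma> n L' R" and nm: "normal \<sigma> n L' R"
      and eq': "\<And>D l. sat n L' R D l \<longleftrightarrow> sat n L0 R D l"
      using ex_normal[OF ovn] by (elim exE conjE) simp
    have agree: "sat n L' R D 0 \<longleftrightarrow> sat n L R D 0" if "D \<in> C" for D
      using agreem[OF that] eq0 eq' by simp
    have "L' k = L k" if "k < n" for k
    proof (rule guards_eq[OF pl tr ov' nm _ _ _ that])
      show "sat n L' R (word n (bump i) R (\<lambda>_. X)) 0 \<longrightarrow> sat n L R (word n (bump i) R (\<lambda>_. X)) 0"
        if "i < n" "X \<subseteq> \<sigma>" for i X
        using agree mem(5)[OF that] by simp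
      show "sat n L' R ?W2 0" using agree[OF mem(2)] W2 by simp
      show "sat n L R (word n g R ((letters L)(i := X))) 0"
        if i: "i < n" "X \<subseteq> \<sigma>" and g: "shape n L i g"
          and all: "\<And>g. shape n L i g \<Longrightarrow> sat n L' R (word n g R ((letters L)(i := X))) 0" for i X g
      proof -
        \<comment> \<open>If \<open>V i X\<close> were a failing word of this shape, the competitor
          would hold in it by \<open>all\<close>, against the agreement on \<open>C\<close>.\<close>
        have "\<not> (\<exists>g. shape n L i g \<and> V i X = word n g R ((letters L)(i := X)) \<and> \<not> sat n L R (V i X) 0)"
          using all agree[OF mem(6)[OF i]] by metis
        then show ?thesis using V[OF i] g by blast
      qed
    qed
    then have "sat n L' R D l \<longleftrightarrow> sat n L R D l" by (intro sat_cong) auto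
    then show ?thesis using m(3) eq0 eq' by simp
  qed
  then show ?thesis using C finC cardC by (intro exI[of _ C]) simp
qed

section \<open>From path queries to embeddings\<close>

lemma holds_conjunction: "holds D l (conjunction As) \<longleftrightarrow> set As \<subseteq> D l"
  by (induction As rule: conjunction.induct) auto

lemma holds_guard: "holds D l (guard g) \<longleftrightarrow> admits (map_option set g) (D l)"
  by (cases g) (simp_all add: holds_conjunction)

lemma emb_Suc:
  "emb (Suc n) L R D f \<longleftrightarrow>
     R 0 \<subseteq> D (f 0) \<and> f 0 < f 1 \<and> (\<forall>y. f 0 < y \<and> y < f 1 \<longrightarrow> admits (L 0) (D y)) \<and>
     emb n (\<lambda>k. L (Suc k)) (\<lambda>k. R (Suc k)) D (\<lambda>k. f (Suc k))"
  unfolding emb_def steps_def less_Suc_eq_le[symmetric] All_less_Suc2 by auto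

text \<open>One unfolding of the semantics of until; it is the induction step that identifies path
  queries with \<open>sat\<close>.\<close>

lemma sat_Suc:
  "sat (Suc n) L R D l \<longleftrightarrow>
     R 0 \<subseteq> D l \<and> (\<exists>m>l. sat n (\<lambda>k. L (Suc k)) (\<lambda>k. R (Suc k)) D m \<and>
       (\<forall>y. l < y \<and> y < m \<longrightarrow> admits (L 0) (D y)))" (is "?l = ?r")
proof
  assume ?l
  then show ?r unfolding sat_def emb_Suc by (elim exE conjE) (rule conjI, simp, rule exI, auto)
next
  assume ?r
  then obtain m f where m: "R 0 \<subseteq> D l" "l < m" "\<forall>y. l < y \<and> y < m \<longrightarrow> admits (L 0) (D y)"
    and f: "f 0 = m" "emb n (\<lambda>k. L (Suc k)) (\<lambda>k. R (Suc k)) D f" unfolding sat_def by blast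
  then show ?l unfolding sat_def emb_Suc by (intro exI[of _ "case_nat l f"]) simp
qed

lemma holds_path_query:
  "holds D l (path_query r0 ps) \<longleftrightarrow>
     sat (length ps) (\<lambda>k. map_option set (fst (ps ! k))) (\<lambda>k. set ((r0 # map snd ps) ! k)) D l"
proof (induction ps arbitrary: r0 l)
  case Nil
  show ?case by (auto simp: holds_conjunction sat_def emb_def steps_def)
next
  case (Cons p ps)
  obtain g r where p: "p = (g, r)" by (cases p)
  show ?case unfolding p by (simp add: Cons.IH sat_Suc holds_conjunction holds_guard)
qed

lemma over_path:
  assumes "set r0 \<subseteq> \<sigma>" "\<forall>p \<in> set ps. step_over \<sigma> p"
  shows "over \<sigma> (length ps) (\<lambda>k. map_option set (fst (ps ! k))) (\<lambda>k. set ((r0 # map snd ps) ! k))"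
proof -
  have step: "set (snd p) \<subseteq> \<sigma>" "fst p = Some s \<Longrightarrow> set s \<subseteq> \<sigma>" if "step_over \<sigma> p" for p s
    using that by (cases p; cases "fst p"; auto)+
  have "set ((r0 # map snd ps) ! k) \<subseteq> \<sigma>" if "k \<le> length ps" for k
    using that assms step(1) by (cases k) simp_all
  moreover have "s \<subseteq> \<sigma>" if k: "k < length ps" "map_option set (fst (ps ! k)) = Some s" for k s
  proof -
    obtain t where t: "fst (ps ! k) = Some t" "s = set t" using k(2) by blast
    have "step_over \<sigma> (ps ! k)" using assms(2) k(1) by simp
    from step(2)[OF this t(1)] t(2) show ?thesis by simp
  qed
  ultimately show ?thesis unfolding over_def by blast
qed

lemma peerless_path:
  assumes "\<forall>p \<in> set ps. peerless_step p"
  shows "peerless (length ps) (\<lambda>k. map_option set (fst (ps ! k))) (\<lambda>k. set ((r0 # map snd ps) ! k))"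
proof -
  have step: "\<not> set s \<subseteq> set (snd p) \<and> \<not> set (snd p) \<subseteq> set s" if "peerless_step p" "fst p = Some s" for p s
    using that by (cases p) auto
  have "\<not> s \<subseteq> set (snd (ps ! k)) \<and> \<not> set (snd (ps ! k)) \<subseteq> s"
    if k: "k < length ps" "map_option set (fst (ps ! k)) = Some s" for k s
  proof -
    obtain t where t: "fst (ps ! k) = Some t" "s = set t" using k(2) by blast
    have "peerless_step (ps ! k)" using assms k(1) by simp
    from step[OF this t(1)] t(2) show ?thesis by simp
  qed
  then show ?thesis by (simp add: peerless_def)
qed

lemma query_size_path: "length ps \<le> query_size (path_query r0 ps)"
  by (induction r0 ps rule: path_query.induct) auto

lemma bounded_data_instance:
  "D \<in> bounded_data \<sigma> N \<Longrightarrow> data_instance \<sigma> D"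
  unfolding bounded_data_def data_instance_def
  by (auto intro!: finite_subset[of "{i. D i \<noteq> {}}" "{..<N}"] simp: not_le[symmetric])

lemma instance_size_bounded:
  assumes "D \<in> bounded_data \<sigma> N" "finite \<sigma>"
  shows "instance_size D \<le> N * card \<sigma>"
proof -
  have sub: "{i. D i \<noteq> {}} \<subseteq> {..<N}" using assms(1) by (auto simp: bounded_data_def not_le[symmetric])
  have "instance_size D \<le> card {i. D i \<noteq> {}} * card \<sigma>"
    unfolding instance_size_def
    using sum_bounded_above[of "{i. D i \<noteq> {}}" "\<lambda>i. card (D i)" "card \<sigma>"] assms
    by (simp add: bounded_data_def card_mono)
  also have "\<dots> \<le> N * card \<sigma>" using card_mono[OF _ sub] by simp
  finally show ?thesis .
qed

theorem theorem14:
  fixes \<sigma> :: "'a set"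
  assumes "finite \<sigma>" and "\<sigma> \<noteq> {}"
  shows "\<exists>f :: nat poly. \<forall>q \<in> peerless_queries \<sigma>. \<exists>E.
           example_set \<sigma> E \<and>
           uniquely_characterises \<sigma> E q (path_queries \<sigma>) \<and>
           examples_size E \<le> poly f (query_size q)"
proof -
  define c where "c = 3 + card \<sigma> + 2 * 2 ^ card \<sigma>"
  \<comment> \<open>\<open>[:4, 1:]\<close> is \<open>x + 4\<close>: there are at most
    \<open>c * (n + 1)\<close> instances, each of size at most
    \<open>(n + 4)\<^sup>2 * card \<sigma>\<close>.\<close>
  define p :: "nat poly" where "p = smult (c * card \<sigma>) ([:4, 1:] ^ 3)"
  show ?thesis
  proof (intro exI[of _ p] ballI)
    fix q assume "q \<in> peerless_queries \<sigma>"
    then obtain r0 ps where q: "q = path_query r0 ps" and r0: "set r0 \<subseteq> \<sigma>"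
      and ps: "\<forall>p \<in> set ps. step_over \<sigma> p" "\<forall>p \<in> set ps. peerless_step p"
      unfolding peerless_queries_def by blast
    define L where "L k = map_option set (fst (ps ! k))" for k
    define R where "R k = set ((r0 # map snd ps) ! k)" for k
    have ov: "over \<sigma> (length ps) L R" using over_path[OF r0 ps(1)] unfolding L_def R_def .
    have pl: "peerless (length ps) L R" using peerless_path[OF ps(2)] unfolding L_def R_def .
    \<comment> \<open>Removing trailing empty letters keeps the query peerless and yields, unless
      \<open>n = 0\<close>, the nonempty last letter that \<open>ex_test_set\<close> asks
      for.\<close>
    obtain n where n: "n \<le> length ps" "n = 0 \<or> R n \<noteq> {}"
      "\<And>D l. sat (length ps) L R D l \<longleftrightarrow> sat n L R D l"
      using sat_trim[where n = "length ps" and R = R and L = L] by (elim exE conjE) simp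
    have holds_q: "holds D l q \<longleftrightarrow> sat n L R D l" for D l
      using n(3) unfolding q holds_path_query L_def R_def by simp
    have pln: "peerless n L R" using pl n(1) by (auto simp: peerless_def)
    obtain C where C: "C \<subseteq> bounded_data \<sigma> ((n + 4)\<^sup>2)" "finite C" "card C \<le> c * (n + 1)"
      and all: "\<forall>m L' R'. over \<sigma> m L' R' \<longrightarrow> (\<forall>D\<in>C. sat m L' R' D 0 \<longleftrightarrow> sat n L R D 0) \<longrightarrow>
        (\<forall>D l. sat m L' R' D l \<longleftrightarrow> sat n L R D l)"
      using ex_test_set[OF assms(1) over_mono[OF ov n(1)] pln n(2)] unfolding c_def[symmetric] by (elim exE conjE) (rule that)
    have char: "sat m L' R' D l \<longleftrightarrow> sat n L R D l"
      if "over \<sigma> m L' R'" "\<forall>D\<in>C. sat m L' R' D 0 \<longleftrightarrow> sat n L R D 0" for m L' R' D l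
      by (rule all[rule_format, OF that(1) that(2)[rule_format]])
    \<comment> \<open>The instances are sorted by evaluating \<open>q\<close>, so fitting
      \<open>E\<close> means agreeing with \<open>q\<close> on \<open>C\<close>.\<close>
    define E where "E = ({D \<in> C. holds D 0 q}, {D \<in> C. \<not> holds D 0 q})"
    have E: "fst E \<union> snd E = C" by (auto simp: E_def)
    have "example_set \<sigma> E"
      unfolding example_set_def E using C bounded_data_instance by (auto simp: E_def)
    moreover have "uniquely_characterises \<sigma> E q (path_queries \<sigma>)"
      unfolding uniquely_characterises_def
    proof (intro conjI ballI impI)
      show "fits q E" by (simp add: fits_def E_def)
      fix q' assume "q' \<in> path_queries \<sigma>" and fit: "fits q' E"
      then obtain r0' ps' where q': "q' = path_query r0' ps'" "set r0' \<subseteq> \<sigma>" "\<forall>p \<in> set ps'. step_over \<sigma> p"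
        unfolding path_queries_def by blast
      have "\<forall>D\<in>C. holds D 0 q' \<longleftrightarrow> sat n L R D 0"
        using fit by (auto simp: fits_def E_def holds_q)
      then have "holds D l q' \<longleftrightarrow> holds D l q" for D l
        unfolding holds_q unfolding q'(1) holds_path_query by (rule char[OF over_path[OF q'(2,3)]])
      then show "equivalent \<sigma> q q'" by (simp add: equivalent_def)
    qed
    moreover have "examples_size E \<le> poly p (query_size q)"
    proof -
      have nq: "n \<le> query_size q" using n(1) query_size_path[of ps r0] q by simp
      have "examples_size E \<le> card C * ((n + 4)\<^sup>2 * card \<sigma>)"
      proof -
        have "instance_size D \<le> (n + 4)\<^sup>2 * card \<sigma>" if "D \<in> C" for D
          using instance_size_bounded[OF _ assms(1)] C(1) that by blast
        then show ?thesis
          using sum_bounded_above[of C instance_size "(n + 4)\<^sup>2 * card \<sigma>"] unfolding examples_size_def E by simp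
      qed
      also have "\<dots> \<le> (c * (n + 4)) * ((n + 4)\<^sup>2 * card \<sigma>)"
      proof (rule mult_le_mono1)
        show "card C \<le> c * (n + 4)" using C(3) by (rule order_trans) (intro mult_le_mono2, simp)
      qed
      also have "\<dots> = c * card \<sigma> * (n + 4) ^ 3" by (simp add: power2_eq_square power3_eq_cube)
      also have "\<dots> \<le> c * card \<sigma> * (query_size q + 4) ^ 3"
        using nq by (intro mult_le_mono2 power_mono) simp_all
      also have "\<dots> = poly p (query_size q)" by (simp add: p_def add.commute)
      finally show ?thesis .
    qed
    ultimately show "\<exists>E. example_set \<sigma> E \<and> uniquely_characterises \<sigma> E q (path_queries \<sigma>) \<and>
        examples_size E \<le> poly p (query_size q)" by blast
  qed
qed

end
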